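(* Let $\tau\in\mathbb{R}$ and consider the continuous convection-diffusion traffic model, for a density $\rho=\rho(x,t)$, $x\in\mathbb{R}$, $t\ge 0$, $$\partial_t \rho + \partial_x\big(\rho V(\rho)\big) = -\tau\,\partial_x\Big(\big(\rho V'(\rho)\big)^2\,\partial_x\rho\Big).$$ The homogeneous configurations for which $\rho(x,t)=\rho_e$ for all $x$ and $t$ are linearly stable for this model if and only if $$\tau<0.$$ (A negative $\tau$ refers to an anticipation time.)
   Context: The parameter $\tau$ is a reaction time if positive and an anticipation time if negative. The function $V$ is the equilibrium (optimal) speed as a function of the density, and $V'$ is its derivative. It is given by $V(k)=W(1/k)$ for $k>0$, where $W$ is the optimal speed as a function of the spacing. $W$ is Lipschitz continuous, non-decreasing, nonnegative, bounded above by some $V_0>0$, and zero for spacings smaller than $\ell$, where $\ell>0$ is the vehicle length or pedestrian size; hence $V$ is non-increasing on $(0,+\infty)$. The constant $\rho_e$ is a density in $(0,+\infty)$, the domain of $V$. Linear stability: write $\rho(x,t)=\rho_e+\varepsilon(x,t)$, substitute into the model and keep only the terms of first order in $\varepsilon$ and its derivatives $\varepsilon_t,\varepsilon_x,\varepsilon_{xx}$; this gives a linear constant-coefficient partial differential equation for the perturbation $\varepsilon$. For each $l>0$, consider the solutions of this linear equation of the form $\varepsilon(x,t)=z\,e^{\lambda t-ixl}$ with $z\neq 0$ and $\lambda=\lambda_l\in\mathbb{C}$. The homogeneous configuration is called linearly stable if these perturbations tend to $0$, i.e. if $\Re(\lambda_l)<0$ for all $l>0$.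
   Formalization: It is additionally assumed that V'(ρ_e) ≠ 0 (otherwise Re λ_l = 0 for every τ, so the claim fails for τ < 0), and that V is twice differentiable near ρ_e with V'' continuous at ρ_e, so that the model and its linearisation make sense there. *)

theory Defs
  imports "HOL-Analysis.Analysis"
begin

text \<open>Difference of the two sides of the model equation, for a density \<open>\<rho> x t\<close>
  (position first, time second).\<close>

definition model_residual ::
    "(real \<Rightarrow> real) \<Rightarrow> real \<Rightarrow> (real \<Rightarrow> real \<Rightarrow> real) \<Rightarrow> real \<Rightarrow> real \<Rightarrow> real" where
  "model_residual V \<tau> \<rho> x t =
     (deriv (\<lambda>s. \<rho> x s) t + deriv (\<lambda>y. \<rho> y t * V (\<rho> y t)) x)
     - (- \<tau> * deriv (\<lambda>y. (\<rho> y t * deriv V (\<rho> y t))\<^sup>2 * deriv (\<lambda>u. \<rho> u t) y) x)"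

text \<open>The linearised equation at \<open>\<rho>\<^sub>e\<close> for a real perturbation \<open>\<epsilon>\<close>: the part of the residual
  of \<open>\<rho>\<^sub>e + \<epsilon>\<close> that is of first order in \<open>\<epsilon>\<close> and its derivatives vanishes. This part is
  the coefficient of \<open>h\<close> when \<open>\<epsilon>\<close> is scaled to \<open>h \<epsilon>\<close>, since \<open>\<epsilon>\<^sub>t\<close>, \<open>\<epsilon>\<^sub>x\<close>, \<open>\<epsilon>\<^sub>x\<^sub>x\<close> scale along.\<close>

definition solves_linearised ::
    "(real \<Rightarrow> real) \<Rightarrow> real \<Rightarrow> real \<Rightarrow> (real \<Rightarrow> real \<Rightarrow> real) \<Rightarrow> bool" where
  "solves_linearised V \<tau> \<rho>\<^sub>e \<epsilon> \<longleftrightarrow>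
     (\<forall>x. \<forall>t\<ge>0. ((\<lambda>h. model_residual V \<tau> (\<lambda>y s. \<rho>\<^sub>e + h * \<epsilon> y s) x t)
        has_real_derivative 0) (at 0))"

text \<open>The linearised equation has real coefficients, so a complex function solves it if and
  only if its real and imaginary parts do.\<close>

definition solves_linearised_complex ::
    "(real \<Rightarrow> real) \<Rightarrow> real \<Rightarrow> real \<Rightarrow> (real \<Rightarrow> real \<Rightarrow> complex) \<Rightarrow> bool" where
  "solves_linearised_complex V \<tau> \<rho>\<^sub>e \<epsilon> \<longleftrightarrow>
     solves_linearised V \<tau> \<rho>\<^sub>e (\<lambda>x t. Re (\<epsilon> x t)) \<and>
     solves_linearised V \<tau> \<rho>\<^sub>e (\<lambda>x t. Im (\<epsilon> x t))"

definition fourier_mode :: "complex \<Rightarrow> complex \<Rightarrow> real \<Rightarrow> real \<Rightarrow> real \<Rightarrow> complex" where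
  "fourier_mode z \<sigma> l x t = z * exp (\<sigma> * of_real t - \<i> * of_real x * of_real l)"

definition linearly_stable :: "(real \<Rightarrow> real) \<Rightarrow> real \<Rightarrow> real \<Rightarrow> bool" where
  "linearly_stable V \<tau> \<rho>\<^sub>e \<longleftrightarrow>
     (\<forall>l>0. \<forall>z \<sigma>. z \<noteq> 0 \<longrightarrow> solves_linearised_complex V \<tau> \<rho>\<^sub>e (fourier_mode z \<sigma> l)
        \<longrightarrow> Re \<sigma> < 0)"

end

theory Submission
  imports Defs
begin

text \<open>
  For a density \<open>\<rho>\<^sub>e + h \<epsilon>\<close> every term of the model residual carries a factor \<open>h\<close>, because each
  contains a derivative of the density. Dividing by \<open>h\<close> and letting \<open>h\<close> tend to \<open>0\<close> freezes the
  coefficients at \<open>\<rho>\<^sub>e\<close> and removes the quadratic term in \<open>\<epsilon>\<^sub>x\<close>, so that the linearised equation is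
  \<open>\<epsilon>\<^sub>t + c \<epsilon>\<^sub>x + \<tau> g \<epsilon>\<^sub>x\<^sub>x = 0\<close> with the wave speed \<open>c = V(\<rho>\<^sub>e) + \<rho>\<^sub>e V'(\<rho>\<^sub>e)\<close> and
  \<open>g = (\<rho>\<^sub>e V'(\<rho>\<^sub>e))\<^sup>2\<close> (lemma \<open>model_residual_first_order\<close>).

  On a Fourier mode the operators \<open>\<partial>\<^sub>t\<close>, \<open>\<partial>\<^sub>x\<close>, \<open>\<partial>\<^sub>x\<^sub>x\<close> act as multiplication by \<open>\<sigma>\<close>, \<open>- \<i> l\<close>,
  \<open>- l\<^sup>2\<close>, and the mode never vanishes. Hence it is a solution exactly when it obeys the dispersion
  relation \<open>\<sigma> = \<tau> g l\<^sup>2 + \<i> l c\<close> (lemma \<open>fourier_mode_solves_iff\<close>). The convection term contributes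
  only to the imaginary part; the growth rate \<open>Re \<sigma> = \<tau> g l\<^sup>2\<close> comes from diffusion alone, and it
  has the sign of \<open>\<tau>\<close> because \<open>g > 0\<close> when \<open>\<rho>\<^sub>e\<close> and \<open>V'(\<rho>\<^sub>e)\<close> are nonzero.
\<close>

text \<open>The residual is \<open>h\<close> times a function of \<open>h\<close> that is continuous at \<open>0\<close>, so its derivative
  there is the value of that function. Continuity of \<open>V''\<close> at \<open>\<rho>\<^sub>e\<close> enters through the term
  \<open>h \<epsilon>\<^sub>x\<^sup>2\<close>, whose coefficient has to stay bounded as \<open>h\<close> tends to \<open>0\<close>.\<close>

lemma model_residual_first_order:
  fixes V :: "real \<Rightarrow> real" and \<epsilon> :: "real \<Rightarrow> real \<Rightarrow> real"
  assumes smooth: "\<forall>\<^sub>F r in nhds \<rho>\<^sub>e. V differentiable (at r) \<and> deriv V differentiable (at r)"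
      "isCont (deriv (deriv V)) \<rho>\<^sub>e"
    and et: "((\<lambda>s. \<epsilon> x s) has_real_derivative et) (at t)"
    and ex: "\<And>y. ((\<lambda>u. \<epsilon> u t) has_real_derivative ex y) (at y)"
    and exx: "(ex has_real_derivative exx) (at x)"
  shows "((\<lambda>h. model_residual V \<tau> (\<lambda>y s. \<rho>\<^sub>e + h * \<epsilon> y s) x t) has_real_derivative
           et + (V \<rho>\<^sub>e + \<rho>\<^sub>e * deriv V \<rho>\<^sub>e) * ex x + \<tau> * (\<rho>\<^sub>e * deriv V \<rho>\<^sub>e)\<^sup>2 * exx) (at 0)"
proof -
  define r where "r h = \<rho>\<^sub>e + h * \<epsilon> x t" for h
  define q where "q h = et + (V (r h) + r h * deriv V (r h)) * ex x
      + \<tau> * ((r h * deriv V (r h))\<^sup>2 * exx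
          + h * (2 * (r h * deriv V (r h))
               * (deriv V (r h) + r h * deriv (deriv V) (r h)) * (ex x)\<^sup>2))" for h
  have r_cont: "isCont r 0" and r_0: "r 0 = \<rho>\<^sub>e"
    unfolding r_def by (auto intro!: continuous_intros)
  have residual_eq: "model_residual V \<tau> (\<lambda>y s. \<rho>\<^sub>e + h * \<epsilon> y s) x t = h * q h"
    if "V differentiable (at (r h))" "deriv V differentiable (at (r h))" for h
  proof -
    have V1: "(V has_real_derivative deriv V (r h)) (at (\<rho>\<^sub>e + h * \<epsilon> x t))"
      and V2: "(deriv V has_real_derivative deriv (deriv V) (r h)) (at (\<rho>\<^sub>e + h * \<epsilon> x t))"
      using that unfolding r_def by (simp_all add: DERIV_deriv_iff_real_differentiable)
    have rho_x: "((\<lambda>u. \<rho>\<^sub>e + h * \<epsilon> u t) has_real_derivative h * ex y) (at y)" for y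
      by (auto intro!: derivative_eq_intros ex)
    have time: "deriv (\<lambda>s. \<rho>\<^sub>e + h * \<epsilon> x s) t = h * et"
      by (rule DERIV_imp_deriv) (auto intro!: derivative_eq_intros et)
    have flux: "deriv (\<lambda>y. (\<rho>\<^sub>e + h * \<epsilon> y t) * V (\<rho>\<^sub>e + h * \<epsilon> y t)) x
        = h * ((V (r h) + r h * deriv V (r h)) * ex x)"
      by (rule DERIV_imp_deriv, rule DERIV_cong,
          rule DERIV_mult[OF rho_x DERIV_chain2[OF V1 rho_x]])
         (simp add: r_def algebra_simps)
    have "((\<lambda>y. ((\<rho>\<^sub>e + h * \<epsilon> y t) * deriv V (\<rho>\<^sub>e + h * \<epsilon> y t))\<^sup>2 * (h * ex y))
        has_real_derivative
          h * ((r h * deriv V (r h))\<^sup>2 * exx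
            + h * (2 * (r h * deriv V (r h))
                 * (deriv V (r h) + r h * deriv (deriv V) (r h)) * (ex x)\<^sup>2))) (at x)"
      by (rule DERIV_cong,
          rule DERIV_mult[OF DERIV_power[OF DERIV_mult[OF rho_x DERIV_chain2[OF V2 rho_x]]]
            DERIV_cmult[OF exx]])
         (simp add: r_def algebra_simps power2_eq_square)
    then have diffusion:
      "deriv (\<lambda>y. ((\<rho>\<^sub>e + h * \<epsilon> y t) * deriv V (\<rho>\<^sub>e + h * \<epsilon> y t))\<^sup>2
          * deriv (\<lambda>u. \<rho>\<^sub>e + h * \<epsilon> u t) y) x
        = h * ((r h * deriv V (r h))\<^sup>2 * exx
            + h * (2 * (r h * deriv V (r h))
                 * (deriv V (r h) + r h * deriv (deriv V) (r h)) * (ex x)\<^sup>2))"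
      by (simp add: DERIV_imp_deriv[OF rho_x] DERIV_imp_deriv)
    show ?thesis
      unfolding model_residual_def time flux diffusion q_def by (simp add: algebra_simps)
  qed
  have "filterlim r (nhds \<rho>\<^sub>e) (nhds 0)"
    using r_cont tendsto_at_iff_tendsto_nhds[of r 0] by (simp add: isCont_def r_0)
  from eventually_compose_filterlim[OF smooth(1) this]
  have near: "\<forall>\<^sub>F h in nhds 0. model_residual V \<tau> (\<lambda>y s. \<rho>\<^sub>e + h * \<epsilon> y s) x t = h * q h"
    by (rule eventually_mono) (use residual_eq in auto)
  have "isCont V (r 0)" "isCont (deriv V) (r 0)"
    using eventually_nhds_x_imp_x[OF smooth(1)]
    by (auto simp: r_0 differentiable_imp_continuous_within)
  moreover have "isCont (deriv (deriv V)) (r 0)"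
    using smooth(2) by (simp add: r_0)
  ultimately have "isCont q 0"
    unfolding q_def by (intro continuous_intros isCont_o2[OF r_cont] r_cont)
  then have "((\<lambda>h. h * q h) has_real_derivative q 0) (at 0)"
    by (auto simp: CARAT_DERIV intro!: exI[of _ q])
  then have "((\<lambda>h. model_residual V \<tau> (\<lambda>y s. \<rho>\<^sub>e + h * \<epsilon> y s) x t)
      has_real_derivative q 0) (at 0)"
    using DERIV_cong_ev[OF refl near refl] by blast
  then show ?thesis
    by (simp add: q_def r_0 mult.assoc)
qed

text \<open>The real-linear functional \<open>L\<close> stands for \<open>Re\<close> and for \<open>Im\<close>, the two components in which
  the linearised equation is tested.\<close>

lemma fourier_mode_component_solves_iff:
  fixes V :: "real \<Rightarrow> real" and L :: "complex \<Rightarrow> real"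
  assumes smooth: "\<forall>\<^sub>F r in nhds \<rho>\<^sub>e. V differentiable (at r) \<and> deriv V differentiable (at r)"
      "isCont (deriv (deriv V)) \<rho>\<^sub>e"
    and L: "bounded_linear L"
  shows "solves_linearised V \<tau> \<rho>\<^sub>e (\<lambda>x t. L (fourier_mode z \<sigma> l x t)) \<longleftrightarrow>
    (\<forall>x. \<forall>t\<ge>0. L ((\<sigma> - \<i> * of_real (l * (V \<rho>\<^sub>e + \<rho>\<^sub>e * deriv V \<rho>\<^sub>e))
        - of_real (\<tau> * (\<rho>\<^sub>e * deriv V \<rho>\<^sub>e)\<^sup>2 * l\<^sup>2)) * fourier_mode z \<sigma> l x t) = 0)"
proof -
  interpret L: bounded_linear L by (rule L)
  let ?c = "V \<rho>\<^sub>e + \<rho>\<^sub>e * deriv V \<rho>\<^sub>e" and ?g = "\<tau> * (\<rho>\<^sub>e * deriv V \<rho>\<^sub>e)\<^sup>2"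
  let ?m = "fourier_mode z \<sigma> l"
  have mode_t: "((\<lambda>s. ?m x s) has_vector_derivative \<sigma> * ?m x t) (at t)" for x t
    unfolding fourier_mode_def
    by (rule has_vector_derivative_eq_rhs,
        rule has_vector_derivative_real_field, (rule derivative_eq_intros refl)+)
       (simp add: algebra_simps)
  have mode_x: "((\<lambda>u. ?m u t) has_vector_derivative - \<i> * of_real l * ?m y t) (at y)" for y t
    unfolding fourier_mode_def
    by (rule has_vector_derivative_eq_rhs,
        rule has_vector_derivative_real_field, (rule derivative_eq_intros refl)+)
       (simp add: algebra_simps)
  have mode_xx: "((\<lambda>u. - \<i> * of_real l * ?m u t) has_vector_derivative
      - of_real (l\<^sup>2) * ?m y t) (at y)" for y t
    using has_vector_derivative_mult_right[OF mode_x, of "- \<i> * of_real l"]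
    by (simp add: algebra_simps power2_eq_square)
  note component = L.has_vector_derivative[folded has_real_derivative_iff_has_vector_derivative]
  have deriv_residual:
    "((\<lambda>h. model_residual V \<tau> (\<lambda>y s. \<rho>\<^sub>e + h * L (?m y s)) x t) has_real_derivative
       L ((\<sigma> - \<i> * of_real (l * ?c) - of_real (?g * l\<^sup>2)) * ?m x t)) (at 0)" for x t
  proof -
    have "(\<sigma> - \<i> * of_real (l * ?c) - of_real (?g * l\<^sup>2)) * ?m x t
        = \<sigma> * ?m x t + ?c *\<^sub>R (- \<i> * of_real l * ?m x t) + ?g *\<^sub>R (- of_real (l\<^sup>2) * ?m x t)"
      by (simp add: scaleR_conv_of_real algebra_simps)
    then have "L ((\<sigma> - \<i> * of_real (l * ?c) - of_real (?g * l\<^sup>2)) * ?m x t)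
        = L (\<sigma> * ?m x t) + ?c * L (- \<i> * of_real l * ?m x t) + ?g * L (- of_real (l\<^sup>2) * ?m x t)"
      by (simp only: L.add L.scaleR real_scaleR_def)
    then show ?thesis
      using model_residual_first_order[where \<epsilon> = "\<lambda>x t. L (?m x t)" and \<tau> = \<tau>,
          OF smooth component[OF mode_t] component[OF mode_x] component[OF mode_xx], of x t]
      by simp
  qed
  then show ?thesis
    unfolding solves_linearised_def by (metis DERIV_unique)
qed

lemma fourier_mode_solves_iff:
  fixes V :: "real \<Rightarrow> real"
  assumes smooth: "\<forall>\<^sub>F r in nhds \<rho>\<^sub>e. V differentiable (at r) \<and> deriv V differentiable (at r)"
      "isCont (deriv (deriv V)) \<rho>\<^sub>e"
    and "z \<noteq> 0"
  shows "solves_linearised_complex V \<tau> \<rho>\<^sub>e (fourier_mode z \<sigma> l) \<longleftrightarrow>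
    \<sigma> = Complex (\<tau> * (\<rho>\<^sub>e * deriv V \<rho>\<^sub>e)\<^sup>2 * l\<^sup>2) (l * (V \<rho>\<^sub>e + \<rho>\<^sub>e * deriv V \<rho>\<^sub>e))"
proof -
  define D where "D = \<sigma> - \<i> * of_real (l * (V \<rho>\<^sub>e + \<rho>\<^sub>e * deriv V \<rho>\<^sub>e))
        - of_real (\<tau> * (\<rho>\<^sub>e * deriv V \<rho>\<^sub>e)\<^sup>2 * l\<^sup>2)"
  have "solves_linearised_complex V \<tau> \<rho>\<^sub>e (fourier_mode z \<sigma> l) \<longleftrightarrow>
      (\<forall>x. \<forall>t\<ge>0. D * fourier_mode z \<sigma> l x t = 0)"
    unfolding solves_linearised_complex_def D_def
      fourier_mode_component_solves_iff[OF smooth bounded_linear_Re]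
      fourier_mode_component_solves_iff[OF smooth bounded_linear_Im]
    by (auto simp: complex_eq_iff)
  also have "\<dots> \<longleftrightarrow> D = 0"
    using \<open>z \<noteq> 0\<close> by (auto simp: fourier_mode_def)
  also have "\<dots> \<longleftrightarrow>
      \<sigma> = Complex (\<tau> * (\<rho>\<^sub>e * deriv V \<rho>\<^sub>e)\<^sup>2 * l\<^sup>2) (l * (V \<rho>\<^sub>e + \<rho>\<^sub>e * deriv V \<rho>\<^sub>e))"
    by (auto simp: D_def complex_eq_iff)
  finally show ?thesis .
qed

theorem proposition3p1:
  fixes W V :: "real \<Rightarrow> real" and V\<^sub>0 vlen \<tau> \<rho>\<^sub>e :: real
  assumes "V\<^sub>0 > 0" and "vlen > 0"
    and "\<exists>L. L-lipschitz_on {0<..} W"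
    and "mono_on {0<..} W"
    and "\<And>s. s > 0 \<Longrightarrow> 0 \<le> W s \<and> W s \<le> V\<^sub>0"
    and "\<And>s. 0 < s \<Longrightarrow> s < vlen \<Longrightarrow> W s = 0"
    and "\<And>k. k > 0 \<Longrightarrow> V k = W (1 / k)"
    and "\<rho>\<^sub>e > 0"
    and smooth: "\<forall>\<^sub>F r in nhds \<rho>\<^sub>e. V differentiable (at r) \<and> deriv V differentiable (at r)"
      "isCont (deriv (deriv V)) \<rho>\<^sub>e"
    and nondegenerate: "deriv V \<rho>\<^sub>e \<noteq> 0"
  shows "linearly_stable V \<tau> \<rho>\<^sub>e \<longleftrightarrow> \<tau> < 0"
proof -
  have g_pos: "(\<rho>\<^sub>e * deriv V \<rho>\<^sub>e)\<^sup>2 > 0"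
    using \<open>\<rho>\<^sub>e > 0\<close> nondegenerate by simp
  have "linearly_stable V \<tau> \<rho>\<^sub>e \<longleftrightarrow> (\<forall>l>0. \<tau> * (\<rho>\<^sub>e * deriv V \<rho>\<^sub>e)\<^sup>2 * l\<^sup>2 < 0)"
    unfolding linearly_stable_def
    using fourier_mode_solves_iff[OF smooth] by (metis complex.sel(1) zero_neq_one)
  also have "\<dots> \<longleftrightarrow> (\<forall>l::real>0. \<tau> < 0)"
    using g_pos by (simp add: mult_less_0_iff zero_less_mult_iff)
  also have "\<dots> \<longleftrightarrow> \<tau> < 0"
    using zero_less_one by blast
  finally show ?thesis .
qed

end
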